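(* For a time- and input-dependent vector field $f:\mathbb{R}_{\ge0}\times\mathbb{R}^n\times\mathbb{R}^k\to\mathbb{R}^n$, consider the dynamics $\dot x=f(t,x,u(t))$, $x(0)=x_0\in\mathcal{X}=\mathbb{R}^n$, where $u$ takes values in $\mathcal{U}=\mathbb{R}^k$. Assume there exist a norm $\|\cdot\|_{\mathcal{X}}$ on $\mathbb{R}^n$ with compatible weak pairing $[\![\cdot,\cdot]\!]_{\mathcal{X}}$ satisfying the curve norm derivative formula for all time, a norm $\|\cdot\|_{\mathcal{U}}$ on $\mathbb{R}^k$, and positive scalars $c$ and $\ell$ such that (A1) $\operatorname{osL}(f(t,\cdot,u))\le -c$ with respect to $[\![\cdot,\cdot]\!]_{\mathcal{X}}$, for all $t\ge0$, $u\in\mathbb{R}^k$; (A2) $\|f(t,x,u)-f(t,x,v)\|_{\mathcal{X}}\le\ell\|u-v\|_{\mathcal{U}}$ for all $t\in\mathbb{R}_{\ge0}$, $x\in\mathbb{R}^n$, $u,v\in\mathbb{R}^k$. Then: (i) any two solutions $x(t)$ and $y(t)$ of the dynamics with continuous input signals $u_x,u_y:\mathbb{R}_{\ge0}\to\mathbb{R}^k$ satisfy, for all $t\ge0$, $$D^+\|x(t)-y(t)\|_{\mathcal{X}}\le -c\|x(t)-y(t)\|_{\mathcal{X}}+\ell\|u_x(t)-u_y(t)\|_{\mathcal{U}};$$ (ii) $f$ is incrementally input-to-state stable, in the sense that, from any initial conditions $x_0,y_0\in\mathbb{R}^n$, $$\|x(t)-y(t)\|_{\mathcal{X}}\le e^{-ct}\|x_0-y_0\|_{\mathcal{X}}+\frac{\ell(1-e^{-ct})}{c}\sup_{\tau\in[0,t]}\|u_x(\tau)-u_y(\tau)\|_{\mathcal{U}};$$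 (iii) $f$ has incremental $\mathcal{L}^q_{\mathcal{X},\mathcal{U}}$ gain bounded by $\ell/c$, for $q\in[1,\infty]$, in the sense that solutions with $x(0)=y(0)$ satisfy $$\|x(\cdot)-y(\cdot)\|_{\mathcal{X},q}\le\frac{\ell}{c}\|u_x(\cdot)-u_y(\cdot)\|_{\mathcal{U},q}.$$ Next, assume that $f$ satisfies the weaker assumptions (A1$'$) and (A2) instead of (A1) and (A2), where (A1$'$) there exist $x^*\in\mathbb{R}^n$ and continuous $u^*:\mathbb{R}_{\ge0}\to\mathbb{R}^k$ such that $f(t,x^*,u^*(t))=0_n$ for all $t$, and $[\![f(t,x,u)-f(t,x^*,u),x-x^*]\!]_{\mathcal{X}}\le -c\|x-x^*\|_{\mathcal{X}}^2$ for all $t\ge0$, $x\in\mathbb{R}^n$, $u\in\mathbb{R}^k$. Then: (iv) the solution $x(t)$ of the dynamics satisfies $D^+\|x(t)-x^*\|_{\mathcal{X}}\le -c\|x(t)-x^*\|_{\mathcal{X}}+\ell\|u(t)-u^*(t)\|_{\mathcal{U}}$ for all $t\ge0$; (v) $f$ is input-to-state stable in the sense that $\|x(t)-x^*\|_{\mathcal{X}}\le e^{-ct}\|x_0-x^*\|_{\mathcal{X}}+\frac{\ell(1-e^{-ct})}{c}\sup_{\tau\in[0,t]}\|u(\tau)-u^*(\tau)\|_{\mathcal{U}}$; (vi) $f$ has $\mathcal{L}^q_{\mathcal{X},\mathcal{U}}$ gain bounded by $\ell/c$, for $q\in[1,\infty]$.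
   Context: A weak pairing on $\mathbb{R}^n$ is a map $[\![\cdot,\cdot]\!]:\mathbb{R}^n\times\mathbb{R}^n\to\mathbb{R}$ such that: (1) $[\![x_1+x_2,y]\!]\le[\![x_1,y]\!]+[\![x_2,y]\!]$ for all $x_1,x_2,y$, and it is continuous in its first argument; (2) $[\![\alpha x,y]\!]=[\![x,\alpha y]\!]=\alpha[\![x,y]\!]$ for all $x,y$ and all $\alpha\ge 0$, and $[\![-x,-y]\!]=[\![x,y]\!]$; (3) $[\![x,x]\!]>0$ for all $x\ne 0_n$; (4) $|[\![x,y]\!]|\le[\![x,x]\!]^{1/2}[\![y,y]\!]^{1/2}$ for all $x,y$. Here $0_n$ is the zero vector of $\mathbb{R}^n$. The weak pairing is compatible with the norm $\|\cdot\|$ if $[\![x,x]\!]=\|x\|^2$ for all $x$. It satisfies the curve norm derivative formula for all time if, for every differentiable $x:\,]a,b[\,\to\mathbb{R}^n$ and every $t\in\,]a,b[$, $\|x(t)\|D^+\|x(t)\|=[\![\dot x(t),x(t)]\!]$. Here $D^+\varphi(t)=\limsup_{h\to0^+}\frac{\varphi(t+h)-\varphi(t)}{h}$ is the upper right Dini derivative. For a map $g:\mathbb{R}^n\to\mathbb{R}^n$, $\operatorname{osL}(g)=\sup_{x\ne y}\frac{[\![g(x)-g(y),x-y]\!]}{\|x-y\|^2}\in\mathbb{R}\cup\{\infty\}$ is the minimal one-sided Lipschitz constant of $g$; the definition of a one-sided Lipschitz map with respect to a weak pairing includes the requirement that the weak pairing satisfies Deimling's inequality $[\![x,y]\!]\le\|y\|\lim_{h\to0^+}\frac{\|y+hx\|-\|y\|}{h}$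 for all $x,y$. For the control system $\dot x=f(t,x,u(t))$, $x(t)$ denotes the solution from $x_0$ subject to the control input $u_x$ (and $y(t)$ the solution from $y_0$ subject to $u_y$); in (iv) and (v), $x(t)$ is the solution from $x_0$ with input $u$. Given a norm $\|\cdot\|_{\mathcal{X}}$ on $\mathcal{X}=\mathbb{R}^n$ and $q\in[1,\infty]$, $\mathcal{L}^q_{\mathcal{X}}$ is the vector space of continuous signals $x:\mathbb{R}_{\ge0}\to\mathbb{R}^n$ with well-defined and bounded norm $\|x(\cdot)\|_{\mathcal{X},q}=\left(\int_0^\infty\|x(t)\|_{\mathcal{X}}^q\,dt\right)^{1/q}$ for $q\neq\infty$ and $\|x(\cdot)\|_{\mathcal{X},\infty}=\sup_{t\ge0}\|x(t)\|_{\mathcal{X}}$; similarly for $\mathcal{U}=\mathbb{R}^k$. A dynamical system with state $x\in\mathcal{X}$ and input $u\in\mathcal{U}$ has $\mathcal{L}^q_{\mathcal{X},\mathcal{U}}$ gain bounded by $\gamma>0$ if, for all $u\in\mathcal{L}^q_{\mathcal{U}}$, the state $x$ from zero initial condition satisfies $\|x(\cdot)\|_{\mathcal{X},q}\le\gamma\|u(\cdot)\|_{\mathcal{U},q}$.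
   Formalization: In (vi) the gain bound is proved for deviations x − x* and u − u* with x(0) = x*; read literally with zero initial state it fails, e.g. for f = −c(x − x* ) + ℓu, u* = u = 0, x* ≠ 0; for x* = 0, u* = 0 it is the stated gain. *)

theory Defs
  imports "HOL-Analysis.Analysis"
begin

definition is_norm :: "('a::real_vector \<Rightarrow> real) \<Rightarrow> bool" where
  "is_norm N \<longleftrightarrow>
     (\<forall>x. 0 \<le> N x) \<and> (\<forall>x. N x = 0 \<longleftrightarrow> x = 0) \<and>
     (\<forall>a x. N (a *\<^sub>R x) = \<bar>a\<bar> * N x) \<and>
     (\<forall>x y. N (x + y) \<le> N x + N y)"

definition weak_pairing :: "(real^'n \<Rightarrow> real^'n \<Rightarrow> real) \<Rightarrow> bool" where
  "weak_pairing W \<longleftrightarrow>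
     (\<forall>x1 x2 y. W (x1 + x2) y \<le> W x1 y + W x2 y) \<and>
     (\<forall>y. continuous_on UNIV (\<lambda>x. W x y)) \<and>
     (\<forall>x y a. 0 \<le> a \<longrightarrow> W (a *\<^sub>R x) y = a * W x y \<and> W x (a *\<^sub>R y) = a * W x y) \<and>
     (\<forall>x y. W (- x) (- y) = W x y) \<and>
     (\<forall>x. x \<noteq> 0 \<longrightarrow> 0 < W x x) \<and>
     (\<forall>x y. \<bar>W x y\<bar> \<le> sqrt (W x x) * sqrt (W y y))"

definition compatible ::
  "(real^'n \<Rightarrow> real) \<Rightarrow> (real^'n \<Rightarrow> real^'n \<Rightarrow> real) \<Rightarrow> bool" where
  "compatible N W \<longleftrightarrow> (\<forall>x. W x x = (N x)\<^sup>2)"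

definition upper_right_dini :: "(real \<Rightarrow> real) \<Rightarrow> real \<Rightarrow> ereal" where
  "upper_right_dini \<phi> t = Limsup (at_right 0) (\<lambda>h. ereal ((\<phi> (t + h) - \<phi> t) / h))"

definition curve_norm_derivative_formula ::
  "(real^'n \<Rightarrow> real) \<Rightarrow> (real^'n \<Rightarrow> real^'n \<Rightarrow> real) \<Rightarrow> bool" where
  "curve_norm_derivative_formula N W \<longleftrightarrow>
     (\<forall>a b x x'. (\<forall>t\<in>{a<..<b}. (x has_vector_derivative x' t) (at t)) \<longrightarrow>
        (\<forall>t\<in>{a<..<b}. ereal (N (x t)) * upper_right_dini (\<lambda>s. N (x s)) t = ereal (W (x' t) (x t))))"

definition deimling_inequality ::
  "(real^'n \<Rightarrow> real) \<Rightarrow> (real^'n \<Rightarrow> real^'n \<Rightarrow> real) \<Rightarrow> bool" where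
  "deimling_inequality N W \<longleftrightarrow>
     (\<forall>x y. \<exists>L. ((\<lambda>h. (N (y + h *\<^sub>R x) - N y) / h) \<longlongrightarrow> L) (at_right 0) \<and> W x y \<le> N y * L)"

definition osL ::
  "(real^'n \<Rightarrow> real) \<Rightarrow> (real^'n \<Rightarrow> real^'n \<Rightarrow> real) \<Rightarrow> (real^'n \<Rightarrow> real^'n) \<Rightarrow> ereal" where
  "osL N W g = (SUP (x, y) \<in> {(x, y). x \<noteq> y}. ereal (W (g x - g y) (x - y) / (N (x - y))\<^sup>2))"

text \<open>
  The vector field is only considered for nonnegative times. Solutions are classical and defined on
  all of \<open>{0..}\<close>; at \<open>t = 0\<close> the derivative is one-sided.
\<close>

definition solution_from ::
  "(real \<Rightarrow> real^'n \<Rightarrow> real^'k \<Rightarrow> real^'n) \<Rightarrow> (real \<Rightarrow> real^'k) \<Rightarrow> real^'n \<Rightarrow> (real \<Rightarrow> real^'n) \<Rightarrow> bool"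
where
  "solution_from f u x0 x \<longleftrightarrow>
     x 0 = x0 \<and> (\<forall>t\<ge>0. (x has_vector_derivative f t (x t) (u t)) (at t within {0..}))"

text \<open>
  The signal norm takes values in \<open>[0, \<infinity>]\<close>. There is no real power on \<^typ>\<open>ennreal\<close>, so the
  infinite case of the outer power \<open>1/q\<close> is treated separately.
\<close>

definition signal_norm :: "('a \<Rightarrow> real) \<Rightarrow> ennreal \<Rightarrow> (real \<Rightarrow> 'a) \<Rightarrow> ennreal" where
  "signal_norm N q x =
     (if q = \<infinity> then (SUP t\<in>{0..}. ennreal (N (x t)))
      else let I = (\<integral>\<^sup>+ t\<in>{0..}. ennreal (N (x t) powr enn2real q) \<partial>lborel)
           in if I = \<infinity> then \<infinity> else ennreal (enn2real I powr (1 / enn2real q)))"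

definition signal_space :: "('a::topological_space \<Rightarrow> real) \<Rightarrow> ennreal \<Rightarrow> (real \<Rightarrow> 'a) set" where
  "signal_space N q = {x. continuous_on {0..} x \<and> signal_norm N q x < \<infinity>}"

definition gain_bounded_by ::
  "(real^'n \<Rightarrow> real) \<Rightarrow> (real^'k \<Rightarrow> real) \<Rightarrow> ennreal \<Rightarrow>
   (real \<Rightarrow> real^'n \<Rightarrow> real^'k \<Rightarrow> real^'n) \<Rightarrow> real \<Rightarrow> bool" where
  "gain_bounded_by NX NU q f \<gamma> \<longleftrightarrow>
     0 < \<gamma> \<and>
     (\<forall>u\<in>signal_space NU q. \<forall>x. solution_from f u 0 x \<longrightarrow>
        signal_norm NX q x \<le> ennreal \<gamma> * signal_norm NU q u)"

text \<open>
  The dynamics in the coordinates \<open>\<xi> = x - x\<^sup>*\<close>, \<open>v = u - u\<^sup>*\<close>. The gain of a system with equilibrium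
  \<open>x\<^sup>*\<close> under the input \<open>u\<^sup>*\<close> is understood in these coordinates: the definition above compares with
  the zero state and the zero input, and in the original coordinates every gain bound can fail if
  \<open>x\<^sup>* \<noteq> 0\<close> (take \<open>f t x u = - (x - x\<^sup>*) + u\<close> with \<open>u = u\<^sup>* = 0\<close>). For \<open>x\<^sup>* = 0\<close> and \<open>u\<^sup>* = 0\<close>
  this is the field \<open>f\<close> itself.
\<close>

definition deviation_field ::
  "(real \<Rightarrow> real^'n \<Rightarrow> real^'k \<Rightarrow> real^'n) \<Rightarrow> real^'n \<Rightarrow> (real \<Rightarrow> real^'k) \<Rightarrow>
   real \<Rightarrow> real^'n \<Rightarrow> real^'k \<Rightarrow> real^'n" where
  "deviation_field f xs us = (\<lambda>t \<xi> v. f t (xs + \<xi>) (us t + v))"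

lemma deviation_field_zero: "deviation_field f 0 (\<lambda>_. 0) = f"
  by (simp add: deviation_field_def)

lemma solution_from_deviation_field_iff:
  "solution_from (deviation_field f xs us) (\<lambda>t. u t - us t) (x0 - xs) (\<lambda>t. x t - xs) \<longleftrightarrow>
   solution_from f u x0 x"
proof -
  have "((\<lambda>t. x t - xs) has_vector_derivative d) F \<longleftrightarrow> (x has_vector_derivative d) F" for d F
    using has_vector_derivative_diff[OF _ has_vector_derivative_const, of x d F xs]
      has_vector_derivative_add[OF _ has_vector_derivative_const, of "\<lambda>t. x t - xs" d F xs]
    by auto
  then show ?thesis
    by (simp add: solution_from_def deviation_field_def)
qed

end

theory Submission
  imports Defs
begin

text \<open>
  In each of the two situations let \<open>z\<close> be the difference of the two states that are compared, \<open>v\<close> that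
  of the two inputs, and \<open>\<phi> t = NX (z t)\<close>. The velocity of \<open>z\<close> is the sum of a difference of \<open>f\<close>
  at two states under the same input, which the one-sided Lipschitz bound controls, and a difference
  at the same state under two inputs, which the Lipschitz bound controls. By subadditivity and the
  Cauchy-Schwarz inequality of the weak pairing, \<open>W (z' t) (z t)\<close> is at most
  \<open>(- c * \<phi> t + l * NU (v t)) * \<phi> t\<close>, and the curve norm derivative formula turns this into
  the differential inequality
  \<open>D\<^sup>+ \<phi> \<le> - c * \<phi> + l * NU v\<close> (\<open>upper_right_dini_norm_curve\<close>). The points with
  \<open>z t = 0\<close>, where the formula says nothing, and the time \<open>0\<close>, which is not interior, need separate
  arguments there. Everything else is a consequence of this scalar inequality.

  The bound in terms of the supremum of the input is a comparison with the solution of a linear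
  equation (\<open>dini_comparison\<close>, \<open>dini_iss_bound\<close>).

  The gain in the integral norms needs no estimate of a convolution. With \<open>b = l / c * NU v\<close>, Young's
  inequality shows that
  \<open>D\<^sup>+ (\<phi> powr q) \<le> q * \<phi> powr (q - 1) * (- c * \<phi> + c * b) \<le> c * b powr q - c * \<phi> powr q\<close>
  (\<open>upper_right_dini_powr_dissipation\<close>). If \<open>\<phi> 0 = 0\<close>, integration over \<open>[0, T]\<close> yields
  \<open>0 \<le> \<phi> T powr q \<le> c * (\<integral> b powr q - \<integral> \<phi> powr q)\<close>, which is the gain \<open>l / c\<close> on every finite
  horizon (\<open>signal_norm_gain\<close>).

  For the gain around an equilibrium, a solution of the deviation field from \<open>0\<close> is the deviation of
  a solution of the original system from \<open>xs\<close>, so the same scalar inequality applies.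
\<close>

section \<open>Norms and weak pairings\<close>

text \<open>
  A norm is a convex function, and convex functions on a finite-dimensional space are continuous.
\<close>

lemma is_norm_continuous_on:
  fixes N :: "'a::euclidean_space \<Rightarrow> real"
  assumes "is_norm N" and "continuous_on S f"
  shows "continuous_on S (\<lambda>x. N (f x))"
proof -
  have "convex_on UNIV N"
  proof (rule convex_onI)
    fix t :: real and x y :: 'a
    assume t: "0 < t" "t < 1"
    have "N ((1 - t) *\<^sub>R x + t *\<^sub>R y) \<le> N ((1 - t) *\<^sub>R x) + N (t *\<^sub>R y)"
      using assms(1) unfolding is_norm_def by blast
    also have "\<dots> = \<bar>1 - t\<bar> * N x + \<bar>t\<bar> * N y"
      using assms(1) unfolding is_norm_def by metis
    finally show "N ((1 - t) *\<^sub>R x + t *\<^sub>R y) \<le> (1 - t) * N x + t * N y"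
      using t by simp
  qed auto
  then have "continuous_on UNIV N"
    by (rule convex_on_continuous[OF open_UNIV])
  then show ?thesis
    using assms(2) by (rule continuous_on_compose2) auto
qed

lemma weak_pairing_le:
  assumes "weak_pairing W" and "compatible N W" and "\<And>x. 0 \<le> N x"
  shows "W x y \<le> N x * N y"
proof -
  have "\<bar>W x y\<bar> \<le> sqrt (W x x) * sqrt (W y y)"
    using assms(1) unfolding weak_pairing_def by blast
  also have "\<dots> = N x * N y"
    using assms(2,3) by (simp add: compatible_def)
  finally show ?thesis by simp
qed

text \<open>
  The drift of the state splits as \<open>a + w\<close>, with \<open>a\<close> the contribution of the states under a common
  input and \<open>w\<close> the effect of the input mismatch. Subadditivity of the pairing separates the two, and
  the Cauchy-Schwarz inequality turns the bound on \<open>w\<close> into a term linear in \<open>N z\<close>, so that one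
  factor \<open>N z\<close> can be cancelled later.
\<close>

lemma weak_pairing_dissipation:
  fixes a w z :: "real^'n"
  assumes "weak_pairing W" and "compatible N W" and "\<And>x. 0 \<le> N x"
    and "W a z \<le> - c * (N z)\<^sup>2" and "N w \<le> g"
  shows "W (a + w) z \<le> (- c * N z + g) * N z"
proof -
  have "W (a + w) z \<le> W a z + W w z" using assms(1) unfolding weak_pairing_def by blast
  also have "W w z \<le> N w * N z" by (rule weak_pairing_le[OF assms(1-3)])
  also have "\<dots> \<le> g * N z" using assms(3,5) by (intro mult_right_mono)
  finally show ?thesis using assms(4) by (simp add: algebra_simps power2_eq_square)
qed

text \<open>
  The supremum only ranges over \<open>x \<noteq> y\<close>; on the diagonal both sides vanish by homogeneity.
\<close>

lemma osL_le_imp_pairing_le: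
  fixes N :: "real^'n \<Rightarrow> real"
  assumes "is_norm N" and "weak_pairing W" and "osL N W g \<le> ereal r"
  shows "W (g x - g y) (x - y) \<le> r * (N (x - y))\<^sup>2"
proof (cases "x = y")
  case True
  have "W (0 *\<^sub>R 0) 0 = 0 * W 0 0" using assms(2) unfolding weak_pairing_def by blast
  moreover have "N 0 = 0" using assms(1) by (auto simp: is_norm_def)
  ultimately show ?thesis using True by simp
next
  case False
  then have "0 < N (x - y)" 
    using assms(1) unfolding is_norm_def by (metis order.order_iff_strict right_minus_eq)
  moreover have "ereal (W (g x - g y) (x - y) / (N (x - y))\<^sup>2) \<le> ereal r"
    using False assms(3) unfolding osL_def SUP_le_iff by auto
  ultimately show ?thesis by (simp add: pos_divide_le_eq)
qed

section \<open>The upper right Dini derivative\<close>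

text \<open>
  An upper bound on the Dini derivative is a family of linear upper bounds on the function just to the
  right of \<open>t\<close>; in this form the bound can be used without extended real arithmetic.
\<close>

lemma upper_right_dini_le_iff:
  "upper_right_dini \<phi> t \<le> ereal b \<longleftrightarrow>
     (\<forall>e>0. \<forall>\<^sub>F h in at_right 0. \<phi> (t + h) < \<phi> t + (b + e) * h)"
proof -
  have slope: "(\<forall>\<^sub>F h in at_right 0. ereal ((\<phi> (t + h) - \<phi> t) / h) < ereal r) \<longleftrightarrow>
      (\<forall>\<^sub>F h in at_right 0. \<phi> (t + h) < \<phi> t + r * h)" for r
  proof -
    have "ereal ((\<phi> (t + h) - \<phi> t) / h) < ereal r \<longleftrightarrow> \<phi> (t + h) < \<phi> t + r * h" if "0 < h" for h
      using that by (auto simp: field_simps)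
    then show ?thesis
      by (intro eventually_cong[OF eventually_at_right_less[of 0]]) auto
  qed
  show ?thesis
  proof
    assume L: "upper_right_dini \<phi> t \<le> ereal b"
    show "\<forall>e>0. \<forall>\<^sub>F h in at_right 0. \<phi> (t + h) < \<phi> t + (b + e) * h"
    proof (intro allI impI)
      fix e :: real assume "e > 0"
      then have "ereal b < ereal (b + e)" by simp
      then show "\<forall>\<^sub>F h in at_right 0. \<phi> (t + h) < \<phi> t + (b + e) * h"
        using L unfolding upper_right_dini_def Limsup_le_iff slope[symmetric] by blast
    qed
  next
    assume R: "\<forall>e>0. \<forall>\<^sub>F h in at_right 0. \<phi> (t + h) < \<phi> t + (b + e) * h"
    show "upper_right_dini \<phi> t \<le> ereal b"
    proof (rule ereal_le_epsilon2)
      fix e :: real assume "e > 0"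
      then have "\<forall>\<^sub>F h in at_right 0. ereal ((\<phi> (t + h) - \<phi> t) / h) < ereal (b + e)"
        using R unfolding slope by blast
      then show "upper_right_dini \<phi> t \<le> ereal b + ereal e"
        unfolding upper_right_dini_def
        by (intro Limsup_bounded) (auto elim: eventually_mono)
    qed
  qed
qed

lemma upper_right_dini_cong:
  assumes "\<And>s. t \<le> s \<Longrightarrow> \<phi> s = \<psi> s"
  shows "upper_right_dini \<phi> t = upper_right_dini \<psi> t"
  unfolding upper_right_dini_def
  by (intro Limsup_eq eventually_mono[OF eventually_at_right_less[of 0]]) (simp add: assms)

lemma tendsto_at_right_shift:
  fixes \<phi> :: "real \<Rightarrow> real"
  assumes "continuous_on {0..} \<phi>" and "0 \<le> t"
  shows "((\<lambda>h. \<phi> (t + h)) \<longlongrightarrow> \<phi> t) (at_right 0)"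
proof -
  have "continuous_on {0..} (\<lambda>h. \<phi> (t + h))"
    by (rule continuous_on_compose2[OF assms(1)]) (use assms(2) in \<open>auto intro!: continuous_intros\<close>)
  then have "((\<lambda>h. \<phi> (t + h)) \<longlongrightarrow> \<phi> (t + 0)) (at 0 within {0..})"
    unfolding continuous_on_def by (rule bspec) simp
  then show ?thesis
    by (auto elim: tendsto_within_subset)
qed

text \<open>
  Young's inequality with exponents \<open>q/(q-1)\<close> and \<open>q\<close>. It is used twice: as the tangent inequality
  of the convex function \<open>a \<mapsto> a powr q\<close>, and to absorb the product of state and input.
\<close>

lemma young_powr:
  fixes a b q :: real
  assumes "1 < q" "0 \<le> a" "0 \<le> b"
  shows "q * (a powr (q - 1) * b) \<le> (q - 1) * a powr q + b powr q"
proof -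
  have conj: "1 / (q / (q - 1)) + 1 / q = 1" "q / (q - 1) > 1"
    using assms by (auto simp: field_simps)
  have "a powr (q - 1) * b \<le> (a powr (q - 1)) powr (q / (q - 1)) / (q / (q - 1)) + b powr q / q"
    using conj assms by (intro Youngs_inequality) auto
  also have "(a powr (q - 1)) powr (q / (q - 1)) = a powr q"
    using assms by (simp add: powr_powr)
  finally show ?thesis
    using assms by (simp add: field_simps)
qed

text \<open>
  The chain rule for \<open>a \<mapsto> a powr q\<close>, as an inequality. With \<open>a = \<phi> (t + h)\<close> and \<open>b = \<phi> t\<close>, convexity
  gives \<open>a powr q - b powr q \<le> q * a powr (q - 1) * (a - b)\<close>, and the factor in front of \<open>a - b\<close> is
  nonnegative and converges as \<open>h\<close> tends to \<open>0\<close>. The restriction \<open>q > 1\<close> is due to the point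
  \<open>\<phi> t = 0\<close>, where \<open>a powr 0\<close> is not continuous.
\<close>

lemma upper_right_dini_powr:
  fixes \<phi> :: "real \<Rightarrow> real"
  assumes "1 < q" and nonneg: "\<And>s. 0 \<le> \<phi> s"
    and cont: "((\<lambda>h. \<phi> (t + h)) \<longlongrightarrow> \<phi> t) (at_right 0)"
    and dini: "upper_right_dini \<phi> t \<le> ereal d"
  shows "upper_right_dini (\<lambda>s. \<phi> s powr q) t \<le> ereal (q * \<phi> t powr (q - 1) * d)"
  unfolding upper_right_dini_le_iff
proof (intro allI impI)
  fix e :: real assume "e > 0"
  define A where "A h = q * \<phi> (t + h) powr (q - 1)" for h
  have A_nonneg: "0 \<le> A h" for h using assms(1) by (simp add: A_def)
  \<comment> \<open>The slack \<open>r\<close> in the bound on \<open>\<phi>\<close> is chosen so that, magnified by \<open>A 0\<close>, it remains below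
    \<open>e\<close>; the \<open>1\<close> in the denominator covers \<open>A 0 = 0\<close>.\<close>
  define r where "r = e / (2 * (A 0 + 1))"
  have "r > 0" using \<open>e > 0\<close> A_nonneg[of 0] by (simp add: r_def)
  have "A 0 * r < e"
  proof -
    have "A 0 < 2 * (A 0 + 1)"
      using A_nonneg[of 0] by simp
    then have "A 0 * e < e * (2 * (A 0 + 1))"
      using \<open>e > 0\<close> by (simp add: mult.commute)
    then show ?thesis using A_nonneg[of 0] by (simp add: r_def field_simps)
  qed
  have "(A \<longlongrightarrow> A 0) (at_right 0)"
    unfolding A_def using cont assms(1) nonneg
    by (auto intro!: tendsto_intros tendsto_powr2)
  then have "((\<lambda>h. A h * (d + r)) \<longlongrightarrow> A 0 * (d + r)) (at_right 0)"
    by (intro tendsto_intros)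
  then have "\<forall>\<^sub>F h in at_right 0. A h * (d + r) < A 0 * d + e"
    by (rule order_tendstoD) (use \<open>A 0 * r < e\<close> in \<open>simp add: algebra_simps\<close>)
  moreover have "\<forall>\<^sub>F h in at_right 0. \<phi> (t + h) < \<phi> t + (d + r) * h"
    using dini \<open>r > 0\<close> unfolding upper_right_dini_le_iff by blast
  ultimately show "\<forall>\<^sub>F h in at_right 0.
      \<phi> (t + h) powr q < \<phi> t powr q + (q * \<phi> t powr (q - 1) * d + e) * h"
    using eventually_at_right_less[of 0]
  proof eventually_elim
    case (elim h)
    have "\<phi> (t + h) powr q \<le> \<phi> t powr q + A h * (\<phi> (t + h) - \<phi> t)"
    proof -
      have "\<phi> (t + h) powr (q - 1) * \<phi> (t + h) = \<phi> (t + h) powr q"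
        using nonneg[of "t + h"] powr_mult_base[of "\<phi> (t + h)" "q - 1"] by (simp add: mult.commute)
      then have base: "A h * \<phi> (t + h) = q * \<phi> (t + h) powr q"
        by (simp add: A_def mult.assoc)
      have "A h * \<phi> t \<le> (q - 1) * \<phi> (t + h) powr q + \<phi> t powr q"
        using young_powr[OF assms(1) nonneg[of "t + h"] nonneg[of t]] by (simp add: A_def mult.assoc)
      then show ?thesis
        unfolding right_diff_distrib base by (simp add: left_diff_distrib)
    qed
    also have "\<dots> \<le> \<phi> t powr q + A h * ((d + r) * h)"
      using elim A_nonneg[of h] by (intro add_left_mono mult_left_mono) auto
    also have "\<dots> = \<phi> t powr q + (A h * (d + r)) * h" by simp
    also have "\<dots> < \<phi> t powr q + (A 0 * d + e) * h"
      using elim by (intro add_strict_left_mono mult_strict_right_mono) auto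
    finally show ?case by (simp add: A_def)
  qed
qed

text \<open>
  The linear differential inequality for \<open>\<phi>\<close> becomes a linear one for its \<open>q\<close>-th power: by the chain
  rule the input enters as \<open>c * q * \<phi> powr (q - 1) * b\<close>, which by Young's inequality costs
  \<open>c * (q - 1) * \<phi> powr q\<close> of the available decay \<open>c * q * \<phi> powr q\<close> and leaves exactly
  \<open>c * b powr q\<close>.
\<close>

lemma upper_right_dini_powr_dissipation:
  fixes \<phi> :: "real \<Rightarrow> real"
  assumes "1 \<le> q" "0 < c" "0 \<le> b" and nonneg: "\<And>s. 0 \<le> \<phi> s"
    and cont: "((\<lambda>h. \<phi> (t + h)) \<longlongrightarrow> \<phi> t) (at_right 0)"
    and dini: "upper_right_dini \<phi> t \<le> ereal (- c * \<phi> t + c * b)"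
  shows "upper_right_dini (\<lambda>s. \<phi> s powr q) t \<le> ereal (c * b powr q - c * \<phi> t powr q)"
proof (cases "q = 1")
  case True
  then show ?thesis using assms by (simp add: algebra_simps)
next
  case False
  then have q: "1 < q" using assms(1) by simp
  have base: "\<phi> t powr (q - 1) * \<phi> t = \<phi> t powr q"
    using nonneg[of t] powr_mult_base[of "\<phi> t" "q - 1"] by (simp add: mult.commute)
  have "q * \<phi> t powr (q - 1) * (- c * \<phi> t + c * b)
      = c * (q * (\<phi> t powr (q - 1) * b)) - c * q * (\<phi> t powr (q - 1) * \<phi> t)"
    by (simp add: algebra_simps)
  also have "\<dots> \<le> c * ((q - 1) * \<phi> t powr q + b powr q) - c * q * \<phi> t powr q"
    unfolding base using young_powr[OF q nonneg assms(3)] \<open>0 < c\<close> by (simp add: mult_left_mono)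
  also have "\<dots> = c * b powr q - c * \<phi> t powr q" by (simp add: algebra_simps)
  finally show ?thesis
    using upper_right_dini_powr[OF q nonneg cont dini] by (meson ereal_less_eq(3) order_trans)
qed

section \<open>Integrating scalar Dini inequalities\<close>

text \<open>
  Only the points where \<open>\<phi>\<close> touches \<open>m\<close> matter. If \<open>\<phi>\<close> exceeded \<open>m\<close> at \<open>T\<close>, then at the last
  time \<open>s\<close> with \<open>\<phi> s \<le> m s\<close> the two functions would agree by the intermediate value theorem; but
  there \<open>m\<close> grows strictly faster than \<open>\<phi>\<close>, so \<open>\<phi>\<close> stays below \<open>m\<close> a little longer.
\<close>

lemma dini_comparison:
  fixes \<phi> m :: "real \<Rightarrow> real"
  assumes T: "0 \<le> T" and cont: "continuous_on {0..T} \<phi>"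
    and m: "\<And>t. t \<in> {0..T} \<Longrightarrow> (m has_real_derivative m' t) (at t within {0..T})"
    and start: "\<phi> 0 \<le> m 0"
    and dini: "\<And>t. 0 \<le> t \<Longrightarrow> t < T \<Longrightarrow> upper_right_dini \<phi> t \<le> ereal (d t)"
    and contact: "\<And>t. 0 \<le> t \<Longrightarrow> t < T \<Longrightarrow> \<phi> t = m t \<Longrightarrow> d t < m' t"
  shows "\<phi> T \<le> m T"
proof (rule ccontr)
  assume neg: "\<not> \<phi> T \<le> m T"
  have contm: "continuous_on {0..T} m"
    using m by (meson DERIV_continuous_on)
  define S where "S = {t \<in> {0..T}. \<phi> t \<le> m t}"
  have "closed S"
    unfolding S_def using cont contm by (intro continuous_on_closed_Collect_le) auto
  have bdd: "bdd_above S" and ne: "S \<noteq> {}"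
    using T start by (auto simp: S_def intro: bdd_aboveI[of _ T])
  define s where "s = Sup S"
  have "s \<in> S"
    unfolding s_def using ne bdd \<open>closed S\<close> by (rule closed_contains_Sup)
  then have s: "0 \<le> s" "s < T" "\<phi> s \<le> m s"
    using neg by (auto simp: S_def order.order_iff_strict)
  have last: "t \<le> s" if "t \<in> S" for t
    unfolding s_def using that bdd by (rule cSup_upper)
  have eq: "\<phi> s = m s"
  proof -
    have "\<exists>t\<ge>s. t \<le> T \<and> \<phi> t - m t = 0"
      using s neg cont contm
      by (intro IVT') (auto intro!: continuous_intros elim: continuous_on_subset)
    then obtain t where "s \<le> t" "t \<le> T" "\<phi> t = m t" by auto
    with last[of t] s show ?thesis by (auto simp: S_def)
  qed
  \<comment> \<open>Half of the gap \<open>m' s - d s\<close> is the error allowed to each of the two linear approximations.\<close>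
  have gap: "d s < m' s" using contact s eq by blast
  define e where "e = (m' s - d s) / 2"
  have e: "e > 0" "d s + e = m' s - e" using gap by (auto simp: e_def field_simps)
  have "\<forall>\<^sub>F h in at_right 0. \<phi> (s + h) < \<phi> s + (d s + e) * h"
    using dini[OF s(1,2)] e(1) unfolding upper_right_dini_le_iff by blast
  moreover have "\<forall>\<^sub>F h in at_right 0. m s + (m' s - e) * h < m (s + h)"
  proof -
    have "(m has_real_derivative m' s) (at s within {s..T})"
      using m[of s] s by (auto elim: has_field_derivative_subset)
    moreover have "at s within {s..T} = at_right s"
      using s by (simp add: at_within_Icc_at_right)
    ultimately have "((\<lambda>y. (m y - m s) / (y - s)) \<longlongrightarrow> m' s) (at_right s)"
      by (simp add: has_field_derivative_iff)
    then have "((\<lambda>h. (m (s + h) - m s) / h) \<longlongrightarrow> m' s) (at_right 0)"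
      by (subst (asm) at_right_to_0) (simp add: filterlim_filtermap add.commute)
    then have "\<forall>\<^sub>F h in at_right 0. m' s - e < (m (s + h) - m s) / h"
      using e by (intro order_tendstoD) auto
    then show ?thesis
      using eventually_at_right_less[of 0] by eventually_elim (auto simp: field_simps)
  qed
  moreover have "\<forall>\<^sub>F h in at_right 0. h < T - s"
    using s by (simp add: eventually_at_right_field) (metis diff_gt_0_iff_gt)
  ultimately have "\<forall>\<^sub>F h in at_right 0. 0 < h \<and> s + h \<in> S"
    using eventually_at_right_less[of 0]
    by eventually_elim (use s eq e in \<open>auto simp: S_def\<close>)
  then obtain h where "0 < h" "s + h \<in> S"
    using eventually_happens trivial_limit_at_right_real by blast
  with last show False by fastforce
qed

text \<open>
  Comparison with the solution of \<open>m' = - c * m + K\<close>, lifted by a constant \<open>e > 0\<close>. The lift makes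
  the derivative of \<open>m\<close> at a contact point larger than \<open>- c * \<phi> + K\<close> by \<open>c * e\<close>.
\<close>

lemma dini_iss_bound:
  fixes \<phi> g :: "real \<Rightarrow> real"
  assumes "0 \<le> T" and "0 < c" and "continuous_on {0..T} \<phi>"
    and dini: "\<And>t. 0 \<le> t \<Longrightarrow> t < T \<Longrightarrow> upper_right_dini \<phi> t \<le> ereal (- c * \<phi> t + g t)"
    and K: "\<And>t. 0 \<le> t \<Longrightarrow> t \<le> T \<Longrightarrow> g t \<le> K"
  shows "\<phi> T \<le> exp (- c * T) * \<phi> 0 + (1 - exp (- c * T)) / c * K"
proof (rule field_le_epsilon)
  fix e :: real assume "e > 0"
  define m where "m t = exp (- c * t) * \<phi> 0 + (1 - exp (- c * t)) / c * K + e" for t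
  define m' where "m' t = - c * (m t - e) + K" for t
  have "\<phi> T \<le> m T"
  proof (rule dini_comparison[where m = m and m' = m'])
    show "(m has_real_derivative m' t) (at t within {0..T})" for t
      unfolding m_def m'_def using \<open>0 < c\<close>
      by (auto intro!: derivative_eq_intros simp: field_simps)
    show "- c * \<phi> t + g t < m' t" if "0 \<le> t" "t < T" "\<phi> t = m t" for t
      using that K[of t] mult_pos_pos[OF \<open>0 < c\<close> \<open>e > 0\<close>] by (simp add: m'_def algebra_simps)
  qed (use assms \<open>e > 0\<close> in \<open>auto simp: m_def\<close>)
  then show "\<phi> T \<le> exp (- c * T) * \<phi> 0 + (1 - exp (- c * T)) / c * K + e"
    by (simp add: m_def)
qed

lemma dini_integral_bound:
  fixes \<phi> p :: "real \<Rightarrow> real"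
  assumes "0 \<le> T" and "continuous_on {0..T} \<phi>" and p: "continuous_on {0..T} p"
    and dini: "\<And>t. 0 \<le> t \<Longrightarrow> t < T \<Longrightarrow> upper_right_dini \<phi> t \<le> ereal (p t)"
  shows "\<phi> T \<le> \<phi> 0 + integral {0..T} p"
proof (rule field_le_epsilon)
  fix e :: real assume "e > 0"
  \<comment> \<open>The slack must grow with time: the comparison function has to be strictly steeper at every
    contact point, and a constant lift would not change its slope.\<close>
  define r where "r = e / (T + 1)"
  have r: "0 < r" "r * T \<le> e"
    using \<open>e > 0\<close> \<open>0 \<le> T\<close> by (auto simp: r_def field_simps)
  define m where "m t = \<phi> 0 + integral {0..t} p + r * t" for t
  have "\<phi> T \<le> m T"
  proof (rule dini_comparison[where m = m and m' = "\<lambda>t. p t + r"])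
    show "(m has_real_derivative p t + r) (at t within {0..T})" if "t \<in> {0..T}" for t
      unfolding m_def using integral_has_real_derivative[OF p that]
      by (auto intro!: derivative_eq_intros)
  qed (use assms r in \<open>auto simp: m_def\<close>)
  then show "\<phi> T \<le> \<phi> 0 + integral {0..T} p + e"
    using r by (simp add: m_def)
qed

section \<open>Bounds on signals from the Dini inequality\<close>

text \<open>
  The supremum over \<open>[0, t]\<close> bounds the input at every time up to \<open>t\<close>, because \<open>v\<close> is continuous and
  hence bounded on this compact interval.
\<close>

lemma iss_sup_bound:
  fixes z :: "real \<Rightarrow> 'a::euclidean_space" and v :: "real \<Rightarrow> 'b::euclidean_space"
  assumes NX: "is_norm NX" and NU: "is_norm NU"
    and z: "continuous_on {0..} z" and v: "continuous_on {0..} v"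
    and "0 < c" "0 < l" "0 \<le> t"
    and dini: "\<And>t. 0 \<le> t \<Longrightarrow>
      upper_right_dini (\<lambda>s. NX (z s)) t \<le> ereal (- c * NX (z t) + l * NU (v t))"
  shows "NX (z t) \<le> exp (- c * t) * NX (z 0)
    + l * (1 - exp (- c * t)) / c * (SUP \<tau>\<in>{0..t}. NU (v \<tau>))"
proof -
  have "compact ((\<lambda>\<tau>. NU (v \<tau>)) ` {0..t})"
    using is_norm_continuous_on[OF NU v]
    by (intro compact_continuous_image) (auto intro: continuous_on_subset)
  then have "bdd_above ((\<lambda>\<tau>. NU (v \<tau>)) ` {0..t})"
    by (intro bounded_imp_bdd_above compact_imp_bounded)
  then have "l * NU (v s) \<le> l * (SUP \<tau>\<in>{0..t}. NU (v \<tau>))" if "0 \<le> s" "s \<le> t" for s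
    using that \<open>0 < l\<close> by (intro mult_left_mono cSUP_upper) auto
  then have "NX (z t) \<le> exp (- c * t) * NX (z 0)
      + (1 - exp (- c * t)) / c * (l * (SUP \<tau>\<in>{0..t}. NU (v \<tau>)))"
    using assms(5-) is_norm_continuous_on[OF NX z]
    by (intro dini_iss_bound[where g = "\<lambda>t. l * NU (v t)"]) (auto intro: continuous_on_subset)
  then show ?thesis by (simp add: mult_ac)
qed

text \<open>
  Passage from finite horizons to the half line by monotone convergence.
\<close>

lemma nn_integral_atLeast_mono:
  fixes h k :: "real \<Rightarrow> real"
  assumes h: "continuous_on {0..} h" "\<And>t. 0 \<le> h t"
    and k: "continuous_on {0..} k" "\<And>t. 0 \<le> k t"
    and le: "\<And>T. 0 \<le> T \<Longrightarrow> integral {0..T} h \<le> integral {0..T} k"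
  shows "(\<integral>\<^sup>+t\<in>{0..}. ennreal (h t) \<partial>lborel) \<le> (\<integral>\<^sup>+t\<in>{0..}. ennreal (k t) \<partial>lborel)"
proof -
  have meas: "(\<lambda>t. indicator {0..T} t * f t) \<in> borel_measurable borel"
    if "continuous_on {0..} f" for f :: "real \<Rightarrow> real" and T
    using borel_measurable_continuous_on_indicator[OF _ continuous_on_subset[OF that], of "{0..T}"]
    by (simp add: subset_eq)
  have fin: "(\<integral>\<^sup>+t\<in>{0..T}. ennreal (f t) \<partial>lborel) = ennreal (integral {0..T} f)"
    if f: "continuous_on {0..} f" "\<And>t. 0 \<le> f t" for f :: "real \<Rightarrow> real" and T
  proof -
    have "f integrable_on {0..T}"
      using f(1) by (intro integrable_continuous_real) (auto intro: continuous_on_subset)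
    then have "(f has_integral integral {0..T} f) {0..T}" by (rule integrable_integral)
    then have "((\<lambda>t. indicator {0..T} t * f t) has_integral integral {0..T} f) UNIV"
      by (subst (asm) has_integral_restrict_UNIV[symmetric])
        (simp add: indicator_def of_bool_def if_distrib if_distribR cong: if_cong)
    from nn_integral_has_integral_lborel[OF meas[OF f(1)] _ this] f(2)
    have "(\<integral>\<^sup>+t. ennreal (indicator {0..T} t * f t) \<partial>lborel) = ennreal (integral {0..T} f)"
      by simp
    moreover have "(\<integral>\<^sup>+t\<in>{0..T}. ennreal (f t) \<partial>lborel)
        = (\<integral>\<^sup>+t. ennreal (indicator {0..T} t * f t) \<partial>lborel)"
      by (intro nn_integral_cong) (auto simp: indicator_def)
    ultimately show ?thesis by simp
  qed
  have lim: "(\<integral>\<^sup>+t\<in>{0..}. ennreal (h t) \<partial>lborel)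
      = (SUP n::nat. \<integral>\<^sup>+t\<in>{0..real n}. ennreal (h t) \<partial>lborel)"
  proof -
    have pt: "ennreal (h t) * indicator {0..} t
        = (SUP n::nat. ennreal (h t) * indicator {0..real n} t)" for t
    proof (rule antisym)
      obtain n :: nat where "t \<le> real n" using real_arch_simple by blast
      then have "ennreal (h t) * indicator {0..} t \<le> ennreal (h t) * indicator {0..real n} t"
        by (auto simp: indicator_def)
      then show "ennreal (h t) * indicator {0..} t
          \<le> (SUP n::nat. ennreal (h t) * indicator {0..real n} t)"
        by (rule order_trans) (auto intro: SUP_upper)
    qed (auto intro!: SUP_least simp: indicator_def)
    have "incseq (\<lambda>n::nat. \<lambda>t. ennreal (h t) * indicator {0..real n} t)"
      by (auto simp: incseq_def le_fun_def indicator_def)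
    moreover have "(\<lambda>t. ennreal (h t) * indicator {0..real n} t) \<in> borel_measurable lborel" for n :: nat
    proof -
      have "(\<lambda>t. ennreal (indicator {0..real n} t * h t)) \<in> borel_measurable lborel"
        using meas[OF h(1)] by simp
      moreover have "ennreal (indicator {0..real n} t * h t)
          = ennreal (h t) * indicator {0..real n} t" for t
        by (auto simp: indicator_def)
      ultimately show ?thesis by simp
    qed
    ultimately show ?thesis
      unfolding pt by (rule nn_integral_monotone_convergence_SUP)
  qed
  show ?thesis
    unfolding lim
  proof (rule SUP_least)
    fix n :: nat
    have "(\<integral>\<^sup>+t\<in>{0..real n}. ennreal (h t) \<partial>lborel) \<le> (\<integral>\<^sup>+t\<in>{0..real n}. ennreal (k t) \<partial>lborel)"
      unfolding fin[OF h] fin[OF k] by (intro ennreal_leI le) simp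
    also have "\<dots> \<le> (\<integral>\<^sup>+t\<in>{0..}. ennreal (k t) \<partial>lborel)"
      by (intro nn_integral_mono) (auto simp: indicator_def)
    finally show "(\<integral>\<^sup>+t\<in>{0..real n}. ennreal (h t) \<partial>lborel)
        \<le> (\<integral>\<^sup>+t\<in>{0..}. ennreal (k t) \<partial>lborel)" .
  qed
qed

text \<open>
  For finite \<open>q\<close>, integrating the differential inequality for the \<open>q\<close>-th power of the state norm over
  \<open>[0, T]\<close>, from a zero initial value to a nonnegative terminal value, bounds the integral of
  \<open>NX (z t) powr q\<close> by that of \<open>(l / c * NU (v t)) powr q\<close>. For \<open>q = \<infinity>\<close> the comparison with
  the largest input norm on \<open>[0, t]\<close> suffices.
\<close>

lemma signal_norm_gain:
  fixes z :: "real \<Rightarrow> 'a::euclidean_space" and v :: "real \<Rightarrow> 'b::euclidean_space"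
  assumes norms: "is_norm NX" "is_norm NU"
    and cont: "continuous_on {0..} z" "continuous_on {0..} v"
    and "0 < c" "0 < l" "1 \<le> q" and "z 0 = 0"
    and dini: "\<And>t. 0 \<le> t \<Longrightarrow>
      upper_right_dini (\<lambda>s. NX (z s)) t \<le> ereal (- c * NX (z t) + l * NU (v t))"
  shows "signal_norm NX q z \<le> ennreal (l / c) * signal_norm NU q v"
proof -
  have NX: "\<And>x. 0 \<le> NX x" and NU: "\<And>u. 0 \<le> NU u" and start: "NX (z 0) = 0"
    using norms \<open>z 0 = 0\<close> by (auto simp: is_norm_def)
  have z: "continuous_on {0..} (\<lambda>t. NX (z t))" and v: "continuous_on {0..} (\<lambda>t. NU (v t))"
    using norms cont by (auto intro: is_norm_continuous_on)
  show ?thesis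
  proof (cases "q = \<infinity>")
    case True
    have "ennreal (NX (z t)) \<le> ennreal (l / c) * (SUP t\<in>{0..}. ennreal (NU (v t)))" if "0 \<le> t" for t
    proof -
      have "\<exists>s\<in>{0..t}. \<forall>\<tau>\<in>{0..t}. NU (v \<tau>) \<le> NU (v s)"
        using that v by (intro continuous_attains_sup) (auto intro: continuous_on_subset)
      then obtain s where s: "s \<in> {0..t}" "\<forall>\<tau>\<in>{0..t}. NU (v \<tau>) \<le> NU (v s)" by blast
      have "NX (z t) \<le> exp (- c * t) * NX (z 0) + (1 - exp (- c * t)) / c * (l * NU (v s))"
        using \<open>0 < c\<close> \<open>0 < l\<close> that dini s z
        by (intro dini_iss_bound[where g = "\<lambda>t. l * NU (v t)"]) (auto intro: continuous_on_subset)
      also have "\<dots> = (1 - exp (- c * t)) * (l / c * NU (v s))"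
        using start by simp
      also have "\<dots> \<le> 1 * (l / c * NU (v s))"
        using \<open>0 < c\<close> \<open>0 < l\<close> NU that by (intro mult_right_mono) auto
      finally have "ennreal (NX (z t)) \<le> ennreal (l / c) * ennreal (NU (v s))"
        using \<open>0 < c\<close> \<open>0 < l\<close> NU by (simp flip: ennreal_mult add: ennreal_leI)
      also have "\<dots> \<le> ennreal (l / c) * (SUP t\<in>{0..}. ennreal (NU (v t)))"
        using s by (intro mult_left_mono SUP_upper) auto
      finally show ?thesis .
    qed
    then show ?thesis
      using True by (auto simp: signal_norm_def intro!: SUP_least)
  next
    case False
    define p where "p = enn2real q"
    have p: "1 \<le> p"
      using \<open>1 \<le> q\<close> False unfolding p_def
      by (cases q) (auto simp: ennreal_1[symmetric] simp del: ennreal_1)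
    define b where "b t = l / c * NU (v t)" for t
    have b: "0 \<le> b t" for t using \<open>0 < c\<close> \<open>0 < l\<close> NU by (simp add: b_def)
    have cb: "c * b t = l * NU (v t)" for t using \<open>0 < c\<close> by (simp add: b_def)
    have contz: "continuous_on {0..} (\<lambda>t. NX (z t) powr p)"
      using z p NX by (intro continuous_on_powr') auto
    have contv: "continuous_on {0..} (\<lambda>t. NU (v t) powr p)"
      using v p NU by (intro continuous_on_powr') auto
    have b_powr: "b t powr p = (l / c) powr p * NU (v t) powr p" for t
      unfolding b_def by (rule powr_mult)
    have contb: "continuous_on {0..} (\<lambda>t. b t powr p)"
      unfolding b_powr by (intro continuous_intros contv)
    have "integral {0..T} (\<lambda>t. NX (z t) powr p) \<le> integral {0..T} (\<lambda>t. b t powr p)"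
      if "0 \<le> T" for T
    proof -
      have contT: "continuous_on {0..T} (\<lambda>t. NX (z t) powr p)" "continuous_on {0..T} (\<lambda>t. b t powr p)"
        using contz contb by (auto intro: continuous_on_subset)
      have "0 \<le> NX (z T) powr p" by simp
      also have "\<dots> \<le> NX (z 0) powr p + integral {0..T} (\<lambda>t. c * b t powr p - c * NX (z t) powr p)"
      proof (rule dini_integral_bound[OF that contT(1)])
        show "upper_right_dini (\<lambda>s. NX (z s) powr p) t \<le> ereal (c * b t powr p - c * NX (z t) powr p)"
          if "0 \<le> t" for t
          using that p NX b \<open>0 < c\<close> dini z
          by (intro upper_right_dini_powr_dissipation tendsto_at_right_shift[of "\<lambda>s. NX (z s)"])
            (auto simp: cb)
      qed (intro continuous_intros contT)
      also have "\<dots> = c * (integral {0..T} (\<lambda>t. b t powr p) - integral {0..T} (\<lambda>t. NX (z t) powr p))"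
        using contT start
        by (subst Henstock_Kurzweil_Integration.integral_diff)
          (auto intro!: integrable_continuous_real continuous_intros simp: right_diff_distrib)
      finally show ?thesis using \<open>0 < c\<close> by (simp add: zero_le_mult_iff)
    qed
    then have "(\<integral>\<^sup>+t\<in>{0..}. ennreal (NX (z t) powr p) \<partial>lborel)
        \<le> (\<integral>\<^sup>+t\<in>{0..}. ennreal (b t powr p) \<partial>lborel)"
      by (intro nn_integral_atLeast_mono contz contb) auto
    also have "\<dots> = (\<integral>\<^sup>+t. ennreal ((l / c) powr p) * (ennreal (indicator {0..} t * NU (v t) powr p)) \<partial>lborel)"
      by (intro nn_integral_cong) (auto simp: b_powr indicator_def ennreal_mult)
    also have "\<dots> = ennreal ((l / c) powr p) * (\<integral>\<^sup>+t. ennreal (indicator {0..} t * NU (v t) powr p) \<partial>lborel)"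
      using borel_measurable_continuous_on_indicator[OF _ contv] by (intro nn_integral_cmult) simp
    also have "(\<integral>\<^sup>+t. ennreal (indicator {0..} t * NU (v t) powr p) \<partial>lborel)
        = (\<integral>\<^sup>+t\<in>{0..}. ennreal (NU (v t) powr p) \<partial>lborel)"
      by (intro nn_integral_cong) (auto simp: indicator_def)
    finally have le: "(\<integral>\<^sup>+t\<in>{0..}. ennreal (NX (z t) powr p) \<partial>lborel)
        \<le> ennreal ((l / c) powr p) * (\<integral>\<^sup>+t\<in>{0..}. ennreal (NU (v t) powr p) \<partial>lborel)"
      (is "?I \<le> ennreal _ * ?J") .
    have signal_norms: "signal_norm NX q z = (if ?I = \<infinity> then \<infinity> else ennreal (enn2real ?I powr (1 / p)))"
      "signal_norm NU q v = (if ?J = \<infinity> then \<infinity> else ennreal (enn2real ?J powr (1 / p)))"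
      using False by (simp_all add: signal_norm_def p_def Let_def)
    show ?thesis
    proof (cases "?J = \<infinity>")
      case True
      then show ?thesis using \<open>0 < c\<close> \<open>0 < l\<close> by (simp add: signal_norms ennreal_mult_top)
    next
      case J: False
      then have rhs: "ennreal ((l / c) powr p) * ?J < \<infinity>"
        by (simp add: ennreal_mult_less_top less_top)
      then have "?I < \<infinity>" using le by (rule le_less_trans[rotated])
      have "enn2real ?I \<le> enn2real (ennreal ((l / c) powr p) * ?J)"
        using le rhs by (intro enn2real_mono) auto
      also have "\<dots> = (l / c) powr p * enn2real ?J"
        by (simp add: enn2real_mult)
      finally have "enn2real ?I powr (1 / p) \<le> ((l / c) powr p * enn2real ?J) powr (1 / p)"
        using p by (intro powr_mono2) auto
      also have "\<dots> = l / c * enn2real ?J powr (1 / p)"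
        using p \<open>0 < c\<close> \<open>0 < l\<close> by (simp add: powr_mult powr_powr)
      finally show ?thesis
        using J less_imp_neq[OF \<open>?I < \<infinity>\<close>] \<open>0 < c\<close> \<open>0 < l\<close> unfolding signal_norms
        by (simp add: ennreal_leI flip: ennreal_mult)
    qed
  qed
qed

section \<open>The norm along a curve\<close>

text \<open>
  Where \<open>z t\<close> is nonzero, the curve norm derivative formula gives \<open>N (z t)\<close> times the Dini derivative
  as a pairing, and \<open>N (z t)\<close> cancels. Where \<open>z t = 0\<close> the formula is void; there
  the Dini derivative is the norm of the velocity, because \<open>N (z (t + h)) / h = N (z (t + h) / h)\<close>.
\<close>

lemma upper_right_dini_norm_curve:
  fixes z z' :: "real \<Rightarrow> real^'n"
  assumes N: "is_norm N" and curve: "curve_norm_derivative_formula N W"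
    and deriv: "\<And>s. 0 \<le> s \<Longrightarrow> (z has_vector_derivative z' s) (at s within {0..})"
    and "0 \<le> t"
    and pairing: "W (z' t) (z t) \<le> (- c * N (z t) + g) * N (z t)"
    and at_zero: "z t = 0 \<Longrightarrow> N (z' t) \<le> g"
  shows "upper_right_dini (\<lambda>s. N (z s)) t \<le> ereal (- c * N (z t) + g)"
proof (cases "z t = 0")
  case True
  have N0: "N 0 = 0" using N by (simp add: is_norm_def)
  have "(z has_vector_derivative z' t) (at t within {t..})"
    using deriv[OF \<open>0 \<le> t\<close>] \<open>0 \<le> t\<close> by (auto elim: has_vector_derivative_within_subset)
  then have "(z has_vector_derivative z' t) (at_right t)"
    by (rule has_vector_derivative_within_subset) auto
  then have "((\<lambda>y. (1 / norm (y - t)) *\<^sub>R (z y - (z t + (y - t) *\<^sub>R z' t))) \<longlongrightarrow> 0) (at_right t)"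
    unfolding has_vector_derivative_def has_derivative_within by blast
  moreover have "\<forall>\<^sub>F y in at_right t.
      (1 / norm (y - t)) *\<^sub>R (z y - (z t + (y - t) *\<^sub>R z' t)) = (z y - z t) /\<^sub>R (y - t) - z' t"
    using eventually_at_right_less[of t]
  proof eventually_elim
    case (elim y)
    have "(1 / norm (y - t)) *\<^sub>R (z y - (z t + (y - t) *\<^sub>R z' t))
        = inverse (y - t) *\<^sub>R ((z y - z t) - (y - t) *\<^sub>R z' t)"
      using elim by (simp add: inverse_eq_divide diff_diff_eq)
    also have "\<dots> = (z y - z t) /\<^sub>R (y - t) - inverse (y - t) *\<^sub>R (y - t) *\<^sub>R z' t"
      by (rule scaleR_diff_right)
    also have "inverse (y - t) *\<^sub>R (y - t) *\<^sub>R z' t = z' t"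
      using elim by simp
    finally show ?case .
  qed
  ultimately have "((\<lambda>y. (z y - z t) /\<^sub>R (y - t) - z' t) \<longlongrightarrow> 0) (at_right t)"
    by (rule Lim_transform_eventually)
  then have "((\<lambda>y. (z y - z t) /\<^sub>R (y - t)) \<longlongrightarrow> z' t) (at_right t)"
    by (rule Lim_null[THEN iffD2])
  then have lim: "((\<lambda>h. z (t + h) /\<^sub>R h) \<longlongrightarrow> z' t) (at_right 0)"
    using True by (subst (asm) at_right_to_0) (simp add: filterlim_filtermap add.commute)
  have "isCont N (z' t)"
    using is_norm_continuous_on[OF N continuous_on_id, of UNIV]
    by (simp add: continuous_on_eq_continuous_at)
  then have Nlim: "((\<lambda>h. N (z (t + h) /\<^sub>R h)) \<longlongrightarrow> N (z' t)) (at_right 0)"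
    using lim by (rule isCont_tendsto_compose)
  show ?thesis
    unfolding upper_right_dini_le_iff
  proof (intro allI impI)
    fix e :: real assume "e > 0"
    then have "\<forall>\<^sub>F h in at_right 0. N (z (t + h) /\<^sub>R h) < g + e"
      using at_zero[OF True] by (intro order_tendstoD[OF Nlim]) simp
    then show "\<forall>\<^sub>F h in at_right 0. N (z (t + h)) < N (z t) + (- c * N (z t) + g + e) * h"
      using eventually_at_right_less[of 0]
    proof eventually_elim
      case (elim h)
      have "N (z (t + h) /\<^sub>R h) = \<bar>inverse h\<bar> * N (z (t + h))"
        using N unfolding is_norm_def by blast
      then have "N (z (t + h)) = h * N (z (t + h) /\<^sub>R h)"
        using elim by simp
      also have "\<dots> < h * (g + e)"
        using elim by (intro mult_strict_left_mono)
      finally show ?case by (simp add: True N0 mult.commute)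
    qed
  qed
next
  case False
  then have pos: "0 < N (z t)" using N unfolding is_norm_def by (metis order.order_iff_strict)
  \<comment> \<open>The formula concerns curves on open intervals. To reach \<open>t = 0\<close>, where only a one-sided
    derivative is known, the curve is continued along its tangent to negative times; the Dini
    derivative looks to the right and does not see the continuation.\<close>
  define y where "y s = (if s \<in> {0..} then z s else z 0 + s *\<^sub>R z' 0)" for s
  define y' where "y' s = (if s \<in> {0..} then z' s else z' 0)" for s
  have y_deriv: "(y has_vector_derivative y' s) (at s)" for s
    unfolding y_def[abs_def] y'_def
  proof (rule has_vector_derivative_If_within_closures[where T = "{..<0}"])
    have cl: "{0::real..} \<union> closure {0..} \<inter> closure {..<0} = {0..}" by auto
    show "(z has_vector_derivative z' s) (at s within {0..} \<union> closure {0..} \<inter> closure {..<0})"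
      if "s \<in> {0..} \<union> closure {0..} \<inter> closure {..<0}"
      using that deriv unfolding cl by simp
    show "((\<lambda>s. z 0 + s *\<^sub>R z' 0) has_vector_derivative z' 0)
        (at s within {..<0} \<union> closure {0..} \<inter> closure {..<0})"
      by (auto intro!: derivative_eq_intros)
  qed auto
  have "ereal (N (z t)) * upper_right_dini (\<lambda>s. N (y s)) t = ereal (W (y' t) (y t))"
  proof -
    have "t \<in> {-1<..<t + 1}" using \<open>0 \<le> t\<close> by simp
    moreover have "\<forall>s\<in>{-1<..<t + 1}. (y has_vector_derivative y' s) (at s)" using y_deriv by simp
    moreover have "y t = z t" using \<open>0 \<le> t\<close> by (simp add: y_def)
    ultimately show ?thesis using curve unfolding curve_norm_derivative_formula_def by metis
  qed
  then have "ereal (N (z t)) * upper_right_dini (\<lambda>s. N (z s)) t = ereal (W (z' t) (z t))"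
    using \<open>0 \<le> t\<close> upper_right_dini_cong[of t "\<lambda>s. N (y s)" "\<lambda>s. N (z s)"]
    by (simp add: y_def y'_def)
  also have "\<dots> \<le> ereal (N (z t)) * ereal (- c * N (z t) + g)"
    using pairing by (simp add: mult.commute)
  finally show ?thesis
    using pos by (subst (asm) ereal_mult_le_mult_iff) auto
qed

section \<open>Dini inequalities for the control system\<close>

lemma solution_from_continuous_on:
  "solution_from f u x0 x \<Longrightarrow> continuous_on {0..} x"
  unfolding solution_from_def continuous_on_eq_continuous_within
  by (auto intro: has_vector_derivative_continuous)

text \<open>
  The velocity of \<open>x - y\<close> is split at \<open>f t (y t) (ux t)\<close>: the first part compares two states under
  the same input and is contracting, the second compares two inputs at the same state.
\<close>

lemma incremental_dini_bound:
  fixes f :: "real \<Rightarrow> real^'n \<Rightarrow> real^'k \<Rightarrow> real^'n"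
  assumes NX: "is_norm NX" and W: "weak_pairing W" "compatible NX W"
    and curve: "curve_norm_derivative_formula NX W"
    and A2: "\<And>t x u v. 0 \<le> t \<Longrightarrow> NX (f t x u - f t x v) \<le> l * NU (u - v)"
    and A1: "\<And>t u. 0 \<le> t \<Longrightarrow> osL NX W (\<lambda>x. f t x u) \<le> ereal (- c)"
    and sol: "solution_from f ux x0 x" "solution_from f uy y0 y" and "0 \<le> t"
  shows "upper_right_dini (\<lambda>s. NX (x s - y s)) t
    \<le> ereal (- c * NX (x t - y t) + l * NU (ux t - uy t))"
proof (rule upper_right_dini_norm_curve[OF NX curve _ \<open>0 \<le> t\<close>])
  show "((\<lambda>s. x s - y s) has_vector_derivative f s (x s) (ux s) - f s (y s) (uy s))
      (at s within {0..})" if "0 \<le> s" for s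
    using sol that by (intro has_vector_derivative_diff) (simp_all add: solution_from_def)
  have NX0: "\<And>x. 0 \<le> NX x" using NX by (simp add: is_norm_def)
  have input: "NX (f t (y t) (ux t) - f t (y t) (uy t)) \<le> l * NU (ux t - uy t)"
    by (rule A2[OF \<open>0 \<le> t\<close>])
  have "W (f t (x t) (ux t) - f t (y t) (ux t)) (x t - y t) \<le> - c * (NX (x t - y t))\<^sup>2"
    by (rule osL_le_imp_pairing_le[OF NX W(1) A1[OF \<open>0 \<le> t\<close>]])
  from weak_pairing_dissipation[OF W NX0 this input]
  show "W (f t (x t) (ux t) - f t (y t) (uy t)) (x t - y t)
      \<le> (- c * NX (x t - y t) + l * NU (ux t - uy t)) * NX (x t - y t)"
    by simp
  show "NX (f t (x t) (ux t) - f t (y t) (uy t)) \<le> l * NU (ux t - uy t)" if "x t - y t = 0"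
    using that input by simp
qed

text \<open>
  The same splitting, at \<open>f t xs (u t)\<close>. The equilibrium condition makes the second part,
  \<open>f t xs (u t) = f t xs (u t) - f t xs (us t)\<close>, a pure input difference, so contraction is only
  needed towards \<open>xs\<close>.
\<close>

lemma equilibrium_dini_bound:
  fixes f :: "real \<Rightarrow> real^'n \<Rightarrow> real^'k \<Rightarrow> real^'n"
  assumes NX: "is_norm NX" and W: "weak_pairing W" "compatible NX W"
    and curve: "curve_norm_derivative_formula NX W"
    and A2: "\<And>t x u v. 0 \<le> t \<Longrightarrow> NX (f t x u - f t x v) \<le> l * NU (u - v)"
    and eq: "\<And>t. 0 \<le> t \<Longrightarrow> f t xs (us t) = 0"
    and diss: "\<And>t x u. 0 \<le> t \<Longrightarrow>
      W (f t x u - f t xs u) (x - xs) \<le> - c * (NX (x - xs))\<^sup>2"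
    and sol: "solution_from f u x0 x" and "0 \<le> t"
  shows "upper_right_dini (\<lambda>s. NX (x s - xs)) t
    \<le> ereal (- c * NX (x t - xs) + l * NU (u t - us t))"
proof (rule upper_right_dini_norm_curve[OF NX curve _ \<open>0 \<le> t\<close>])
  show "((\<lambda>s. x s - xs) has_vector_derivative f s (x s) (u s)) (at s within {0..})"
    if "0 \<le> s" for s
    using has_vector_derivative_diff[OF _ has_vector_derivative_const, of x _ _ xs] sol that
    by (simp add: solution_from_def)
  have input: "NX (f t xs (u t)) \<le> l * NU (u t - us t)"
    using A2[OF \<open>0 \<le> t\<close>, of xs "u t" "us t"] eq[OF \<open>0 \<le> t\<close>] by simp
  have NX0: "\<And>x. 0 \<le> NX x" using NX by (simp add: is_norm_def)
  show "W (f t (x t) (u t)) (x t - xs) \<le> (- c * NX (x t - xs) + l * NU (u t - us t)) * NX (x t - xs)"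
    using weak_pairing_dissipation[OF W NX0 diss[OF \<open>0 \<le> t\<close>] input, of "x t" "u t"] by simp
  show "NX (f t (x t) (u t)) \<le> l * NU (u t - us t)" if "x t - xs = 0"
    using that input by simp
qed

section \<open>Input-to-state stability of contracting systems\<close>

theorem theorem37:
  fixes f :: "real \<Rightarrow> real^'n \<Rightarrow> real^'k \<Rightarrow> real^'n"
    and NX :: "real^'n \<Rightarrow> real" and NU :: "real^'k \<Rightarrow> real"
    and W :: "real^'n \<Rightarrow> real^'n \<Rightarrow> real"
    and c l :: real
  assumes "is_norm NX" and "is_norm NU"
    and "weak_pairing W" and "compatible NX W" and "curve_norm_derivative_formula NX W"
    and "0 < c" and "0 < l"
    and A2: "\<And>t x u v. 0 \<le> t \<Longrightarrow> NX (f t x u - f t x v) \<le> l * NU (u - v)"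
  shows
    "(deimling_inequality NX W \<and> (\<forall>t\<ge>0. \<forall>u. osL NX W (\<lambda>x. f t x u) \<le> ereal (- c)) \<longrightarrow>
       (\<forall>ux uy x0 y0 x y.
          continuous_on {0..} ux \<and> continuous_on {0..} uy \<and>
          solution_from f ux x0 x \<and> solution_from f uy y0 y \<longrightarrow>
          (\<forall>t\<ge>0. upper_right_dini (\<lambda>s. NX (x s - y s)) t
                 \<le> ereal (- c * NX (x t - y t) + l * NU (ux t - uy t))) \<and>
          (\<forall>t\<ge>0. NX (x t - y t)
                 \<le> exp (- c * t) * NX (x0 - y0)
                    + l * (1 - exp (- c * t)) / c * (SUP \<tau>\<in>{0..t}. NU (ux \<tau> - uy \<tau>))) \<and>
          (x0 = y0 \<longrightarrow>
             (\<forall>q\<ge>1. signal_norm NX q (\<lambda>t. x t - y t)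
                    \<le> ennreal (l / c) * signal_norm NU q (\<lambda>t. ux t - uy t)))))
     \<and>
     (\<forall>xs us.
        continuous_on {0..} us \<and> (\<forall>t\<ge>0. f t xs (us t) = 0) \<and>
        (\<forall>t\<ge>0. \<forall>x u. W (f t x u - f t xs u) (x - xs) \<le> - c * (NX (x - xs))\<^sup>2) \<longrightarrow>
        (\<forall>u x0 x.
           continuous_on {0..} u \<and> solution_from f u x0 x \<longrightarrow>
           (\<forall>t\<ge>0. upper_right_dini (\<lambda>s. NX (x s - xs)) t
                  \<le> ereal (- c * NX (x t - xs) + l * NU (u t - us t))) \<and>
           (\<forall>t\<ge>0. NX (x t - xs)
                  \<le> exp (- c * t) * NX (x0 - xs)
                     + l * (1 - exp (- c * t)) / c * (SUP \<tau>\<in>{0..t}. NU (u \<tau> - us \<tau>)))) \<and>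
        (\<forall>q\<ge>1. gain_bounded_by NX NU q (deviation_field f xs us) (l / c)))"
proof (intro conjI impI allI; (elim conjE)?)
  fix ux uy x0 y0 x y
  assume A1: "\<forall>t\<ge>0. \<forall>u. osL NX W (\<lambda>x. f t x u) \<le> ereal (- c)"
    and u: "continuous_on {0..} ux" "continuous_on {0..} uy"
    and sol: "solution_from f ux x0 x" "solution_from f uy y0 y"
  have dini: "upper_right_dini (\<lambda>s. NX (x s - y s)) t
      \<le> ereal (- c * NX (x t - y t) + l * NU (ux t - uy t))" if "0 \<le> t" for t
    using A1 that by (intro incremental_dini_bound[where f = f and W = W, OF _ _ _ _ _ _ sol] assms) auto
  have cont: "continuous_on {0..} (\<lambda>t. x t - y t)" "continuous_on {0..} (\<lambda>t. ux t - uy t)"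
    using u sol[THEN solution_from_continuous_on] by (auto intro: continuous_intros)
  have init: "x 0 = x0" "y 0 = y0" using sol by (auto simp: solution_from_def)
  {
    fix t :: real assume "0 \<le> t"
    then show "upper_right_dini (\<lambda>s. NX (x s - y s)) t
        \<le> ereal (- c * NX (x t - y t) + l * NU (ux t - uy t))"
      by (rule dini)
  next
    fix t :: real assume "0 \<le> t"
    from iss_sup_bound[OF assms(1,2) cont assms(6,7) this dini]
    show "NX (x t - y t) \<le> exp (- c * t) * NX (x0 - y0)
        + l * (1 - exp (- c * t)) / c * (SUP \<tau>\<in>{0..t}. NU (ux \<tau> - uy \<tau>))"
      by (simp add: init)
  next
    fix q :: ennreal assume "x0 = y0" "1 \<le> q"
    then show "signal_norm NX q (\<lambda>t. x t - y t) \<le> ennreal (l / c) * signal_norm NU q (\<lambda>t. ux t - uy t)"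
      using assms(1,2,6,7) init dini cont by (intro signal_norm_gain) auto
  }
next
  fix xs us
  assume us: "continuous_on {0..} us" and eq: "\<forall>t\<ge>0. f t xs (us t) = 0"
    and diss: "\<forall>t\<ge>0. \<forall>x u. W (f t x u - f t xs u) (x - xs) \<le> - c * (NX (x - xs))\<^sup>2"
  have dini: "upper_right_dini (\<lambda>s. NX (x s - xs)) t
      \<le> ereal (- c * NX (x t - xs) + l * NU (u t - us t))"
    if "solution_from f u x0 x" "0 \<le> t" for u x0 x t
    using eq diss that by (intro equilibrium_dini_bound[where f = f and W = W] assms) auto
  {
    fix u x0 x and t :: real
    assume "solution_from f u x0 x" "0 \<le> t"
    then show "upper_right_dini (\<lambda>s. NX (x s - xs)) t
        \<le> ereal (- c * NX (x t - xs) + l * NU (u t - us t))"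
      by (rule dini)
  next
    fix u x0 x and t :: real
    assume u: "continuous_on {0..} u" and sol: "solution_from f u x0 x" and "0 \<le> t"
    have cont: "continuous_on {0..} (\<lambda>t. x t - xs)" "continuous_on {0..} (\<lambda>t. u t - us t)"
      using u us solution_from_continuous_on[OF sol] by (auto intro: continuous_intros)
    have "x 0 = x0" using sol by (simp add: solution_from_def)
    with iss_sup_bound[OF assms(1,2) cont assms(6,7) \<open>0 \<le> t\<close> dini[OF sol]]
    show "NX (x t - xs) \<le> exp (- c * t) * NX (x0 - xs)
        + l * (1 - exp (- c * t)) / c * (SUP \<tau>\<in>{0..t}. NU (u \<tau> - us \<tau>))"
      by simp
  next
    fix q :: ennreal assume "1 \<le> q"
    show "gain_bounded_by NX NU q (deviation_field f xs us) (l / c)"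
      unfolding gain_bounded_by_def
    proof (intro conjI ballI allI impI)
      fix v \<xi> assume v: "v \<in> signal_space NU q"
        and sol: "solution_from (deviation_field f xs us) v 0 \<xi>"
      have "solution_from f (\<lambda>t. us t + v t) xs (\<lambda>t. xs + \<xi> t)"
        using sol solution_from_deviation_field_iff[of f xs us "\<lambda>t. us t + v t" xs "\<lambda>t. xs + \<xi> t"]
        by simp
      from dini[OF this]
      have "upper_right_dini (\<lambda>s. NX (\<xi> s)) t \<le> ereal (- c * NX (\<xi> t) + l * NU (v t))"
        if "0 \<le> t" for t
        using that by simp
      moreover have "continuous_on {0..} \<xi>" "continuous_on {0..} v" "\<xi> 0 = 0"
        using v sol solution_from_continuous_on[OF sol]
        by (auto simp: signal_space_def solution_from_def)
      ultimately show "signal_norm NX q \<xi> \<le> ennreal (l / c) * signal_norm NU q v"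
        using assms(1,2,6,7) \<open>1 \<le> q\<close> by (intro signal_norm_gain) auto
    qed (use assms in simp)
  }
qed

end
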